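(* Let $\Psi=(E,\Delta)$ be a pure ordered simplicial complex in the class QC. An independent set $I$ of $\Psi$ is independent in $\mathrm{nbc}(\Psi)$ if and only if $I$ contains no broken circuit of $\Psi$.
   Context: An ordered simplicial complex is a pair $\Psi=(E,\Delta)$ with $E$ a finite totally ordered set and $\Delta\subseteq 2^E$ a simplicial complex (closed under taking subsets, $\emptyset\in\Delta$). Elements of $\Delta$ are independent sets; inclusion-maximal ones are bases; inclusion-minimal subsets of $E$ not in $\Delta$ are circuits. $\Psi$ is pure if all bases have the same cardinality. QC: the class of $\Psi$ such that if $C_1\neq C_2$ are circuits and $c\in C_1\cap C_2$ satisfies $c<\max (C_1\triangle C_2)$ (symmetric difference), then there is a circuit $C_3\subseteq (C_1\cup C_2)\setminus\{c\}$. A broken circuit of $\Psi$ is a set $C\setminus\{c\}$ where $C$ is a circuit and $c$ is the smallest element of $C$. The complex $\mathrm{nbc}(\Psi)$ on $E$ is the one whose bases are the bases of $\Psi$ that contain no broken circuit; its independent sets are the subsets of these bases (it is the void complex, with no independent sets at all, if there are no such bases). *)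

theory Defs
  imports Main
begin

text \<open>
  An ordered simplicial complex is a pair \<open>(E, \<Delta>)\<close>. The total order on the finite ground
  set \<open>E\<close> is the one it inherits from the linearly ordered element type.
\<close>

type_synonym 'a complex = "'a set \<times> 'a set set"

abbreviation ground :: "'a complex \<Rightarrow> 'a set" where
  "ground \<equiv> fst"

abbreviation faces :: "'a complex \<Rightarrow> 'a set set" where
  "faces \<equiv> snd"

definition ordered_simplicial_complex :: "'a::linorder complex \<Rightarrow> bool" where
  "ordered_simplicial_complex \<Psi> \<longleftrightarrow>
     finite (ground \<Psi>) \<and> faces \<Psi> \<subseteq> Pow (ground \<Psi>) \<and> {} \<in> faces \<Psi> \<and>
     (\<forall>I\<in>faces \<Psi>. \<forall>J\<subseteq>I. J \<in> faces \<Psi>)"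

definition independent :: "'a complex \<Rightarrow> 'a set \<Rightarrow> bool" where
  "independent \<Psi> I \<longleftrightarrow> I \<in> faces \<Psi>"

definition basis :: "'a complex \<Rightarrow> 'a set \<Rightarrow> bool" where
  "basis \<Psi> B \<longleftrightarrow> independent \<Psi> B \<and> (\<forall>I. independent \<Psi> I \<longrightarrow> \<not> B \<subset> I)"

definition circuit :: "'a complex \<Rightarrow> 'a set \<Rightarrow> bool" where
  "circuit \<Psi> C \<longleftrightarrow>
     C \<subseteq> ground \<Psi> \<and> \<not> independent \<Psi> C \<and> (\<forall>D. D \<subset> C \<longrightarrow> independent \<Psi> D)"

definition pure_complex :: "'a complex \<Rightarrow> bool" where
  "pure_complex \<Psi> \<longleftrightarrow> (\<forall>B B'. basis \<Psi> B \<longrightarrow> basis \<Psi> B' \<longrightarrow> card B = card B')"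

definition QC :: "'a::linorder complex set" where
  "QC = {\<Psi>. ordered_simplicial_complex \<Psi> \<and>
     (\<forall>C\<^sub>1 C\<^sub>2 c. circuit \<Psi> C\<^sub>1 \<longrightarrow> circuit \<Psi> C\<^sub>2 \<longrightarrow> C\<^sub>1 \<noteq> C\<^sub>2 \<longrightarrow> c \<in> C\<^sub>1 \<inter> C\<^sub>2 \<longrightarrow>
        c < Max ((C\<^sub>1 - C\<^sub>2) \<union> (C\<^sub>2 - C\<^sub>1)) \<longrightarrow>
        (\<exists>C\<^sub>3. circuit \<Psi> C\<^sub>3 \<and> C\<^sub>3 \<subseteq> (C\<^sub>1 \<union> C\<^sub>2) - {c}))}"

definition broken_circuit :: "'a::linorder complex \<Rightarrow> 'a set \<Rightarrow> bool" where
  "broken_circuit \<Psi> D \<longleftrightarrow> (\<exists>C. circuit \<Psi> C \<and> D = C - {Min C})"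

definition contains_no_broken_circuit :: "'a::linorder complex \<Rightarrow> 'a set \<Rightarrow> bool" where
  "contains_no_broken_circuit \<Psi> I \<longleftrightarrow> \<not> (\<exists>D. broken_circuit \<Psi> D \<and> D \<subseteq> I)"

text \<open>
  If no basis is free of broken circuits (for instance if some singleton is a circuit, so that
  the empty set is a broken circuit), then \<open>nbc \<Psi>\<close> is the void complex, whose set of faces is
  empty; it is then not an ordered simplicial complex in the above sense.
\<close>

definition nbc :: "'a::linorder complex \<Rightarrow> 'a complex" where
  "nbc \<Psi> = (ground \<Psi>,
     {I. \<exists>B. basis \<Psi> B \<and> contains_no_broken_circuit \<Psi> B \<and> I \<subseteq> B})"

end

theory Submission
  imports Defs
begin

text \<open>
  Among the bases containing \<open>I\<close>, take one, \<open>B\<close>, whose elements have the least total rank in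
  the ground set. If \<open>B\<close> contained a broken circuit \<open>C - {c}\<close>, then \<open>C\<close> would be the only circuit
  inside \<open>B \<union> {c}\<close>: eliminating the minimum \<open>c\<close> of \<open>C\<close> from \<open>C\<close> and another such circuit,
  as QC permits, gives a circuit inside \<open>B\<close>. Hence exchanging any \<open>x \<in> C - {c}\<close> outside \<open>I\<close> for
  \<open>c < x\<close> gives an independent set, which is a basis by purity, of smaller total rank.
\<close>

lemma independent_mono:
  assumes "ordered_simplicial_complex \<Psi>" "independent \<Psi> J" "I \<subseteq> J"
  shows "independent \<Psi> I"
  using assms unfolding ordered_simplicial_complex_def independent_def by blast

lemma finite_faces:
  assumes "ordered_simplicial_complex \<Psi>"
  shows "finite (faces \<Psi>)"
  using assms unfolding ordered_simplicial_complex_def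
  by (metis finite_Pow_iff finite_subset)

lemma independent_subset_ground:
  assumes "ordered_simplicial_complex \<Psi>" "independent \<Psi> I"
  shows "I \<subseteq> ground \<Psi>"
  using assms unfolding ordered_simplicial_complex_def independent_def by blast

lemma finite_independent:
  assumes "ordered_simplicial_complex \<Psi>" "independent \<Psi> I"
  shows "finite I"
  using independent_subset_ground[OF assms] assms(1) finite_subset[of I "ground \<Psi>"]
  unfolding ordered_simplicial_complex_def by simp

lemma circuit_nonempty:
  assumes "ordered_simplicial_complex \<Psi>" "circuit \<Psi> C"
  shows "C \<noteq> {}"
  using assms unfolding ordered_simplicial_complex_def circuit_def independent_def by blast

lemma finite_circuit:
  assumes "ordered_simplicial_complex \<Psi>" "circuit \<Psi> C"
  shows "finite C"
  using assms finite_subset[of C "ground \<Psi>"]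
  unfolding ordered_simplicial_complex_def circuit_def by simp

text \<open>There are only finitely many faces, so some inclusion-maximal face lies above
  \<open>I\<close>.\<close>

lemma independent_extends_to_basis:
  assumes "ordered_simplicial_complex \<Psi>" "independent \<Psi> I"
  obtains B where "basis \<Psi> B" "I \<subseteq> B"
proof -
  obtain B where B: "B \<in> faces \<Psi>" "I \<subseteq> B" "\<And>J. J \<in> faces \<Psi> \<Longrightarrow> B \<subseteq> J \<Longrightarrow> B = J"
    using finite_has_maximal2[OF finite_faces[OF assms(1)]] assms(2)
    unfolding independent_def by metis
  then show thesis
    using that[of B] unfolding basis_def independent_def by blast
qed

text \<open>Descend through dependent proper subsets; by finiteness this stops at a dependent set
  all of whose proper subsets are independent.\<close>

lemma dependent_contains_circuit:
  assumes "ordered_simplicial_complex \<Psi>" "D \<subseteq> ground \<Psi>" "\<not> independent \<Psi> D"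
  obtains C where "circuit \<Psi> C" "C \<subseteq> D"
proof -
  have "finite D"
    using assms(1,2) finite_subset[of D "ground \<Psi>"]
    unfolding ordered_simplicial_complex_def by simp
  then have "\<exists>C. circuit \<Psi> C \<and> C \<subseteq> D" using assms(2,3)
  proof (induction D rule: finite_psubset_induct)
    case (psubset D)
    show ?case
    proof (cases "\<exists>A. A \<subset> D \<and> \<not> independent \<Psi> A")
      case True
      then obtain A where A: "A \<subset> D" "\<not> independent \<Psi> A" by blast
      then have "A \<subseteq> ground \<Psi>" using psubset.prems(1) by blast
      then obtain C where "circuit \<Psi> C" "C \<subseteq> A" using psubset.IH[OF A(1) _ A(2)] by blast
      then show ?thesis using A(1) by blast
    next
      case False
      then have "circuit \<Psi> D" using psubset.prems unfolding circuit_def by simp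
      then show ?thesis by blast
    qed
  qed
  then show thesis using that by blast
qed

lemma circuit_subset_eq:
  assumes "circuit \<Psi> C" "circuit \<Psi> C'" "C \<subseteq> C'"
  shows "C = C'"
  using assms unfolding circuit_def by blast

text \<open>Purity gives a basis extending \<open>I\<close> the same cardinality as
  \<open>I\<close>, so the two coincide. This lets a cardinality count certify that an exchange
  yields a basis.\<close>

lemma pure_independent_card_basis:
  assumes "ordered_simplicial_complex \<Psi>" "pure_complex \<Psi>"
    and "basis \<Psi> B" "independent \<Psi> I" "card I = card B"
  shows "basis \<Psi> I"
proof -
  obtain B' where B': "basis \<Psi> B'" "I \<subseteq> B'"
    using independent_extends_to_basis[OF assms(1,4)] .
  then have "card I = card B'"
    using assms(2,3,5) unfolding pure_complex_def by metis
  moreover have "finite B'"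
    using B'(1) finite_independent[OF assms(1)] unfolding basis_def by blast
  ultimately show ?thesis
    using B' card_subset_eq by metis
qed

text \<open>Two different such circuits would share \<open>Min C\<close>, and eliminating it would
  leave a circuit inside the independent set \<open>B\<close>. The restricted elimination of QC
  suffices because the element removed is the minimum of \<open>C\<close>.\<close>

lemma QC_circuit_unique:
  assumes "\<Psi> \<in> QC" "independent \<Psi> B"
    and C: "circuit \<Psi> C" "C \<subseteq> insert (Min C) B"
    and C': "circuit \<Psi> C'" "C' \<subseteq> insert (Min C) B"
  shows "C' = C"
proof (rule ccontr)
  assume neq: "C' \<noteq> C"
  have osc: "ordered_simplicial_complex \<Psi>" using assms(1) unfolding QC_def by blast
  have no_circuit: "\<not> A \<subseteq> B" if "circuit \<Psi> A" for A
    using that assms(2) independent_mono[OF osc] unfolding circuit_def by blast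
  have mem: "Min C \<in> C \<inter> C'" using no_circuit C C' by blast
  \<comment> \<open>Circuits form an antichain, so \<open>C\<close> is not contained in
    \<open>C'\<close>. The element \<open>y\<close> witnesses the order condition of QC: it lies in
    the symmetric difference and, being in \<open>C\<close> but different from \<open>Min C\<close>,
    exceeds \<open>Min C\<close>.\<close>
  obtain y where y: "y \<in> C" "y \<notin> C'" using circuit_subset_eq C(1) C'(1) neq by blast
  have fin: "finite C" "finite C'" using finite_circuit[OF osc] C(1) C'(1) by auto
  have "Min C < y" using fin y mem Min_le[of C y] by (auto simp: order_less_le)
  also have "y \<le> Max ((C - C') \<union> (C' - C))" using fin y by (intro Max_ge) auto
  finally obtain C3 where "circuit \<Psi> C3" "C3 \<subseteq> (C \<union> C') - {Min C}"
    using assms(1) C(1) C'(1) neq mem unfolding QC_def by blast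
  then show False using no_circuit C(2) C'(2) by blast
qed

text \<open>A circuit in the exchanged set would lie in \<open>insert (Min C) B\<close> and hence be
  \<open>C\<close> itself, but \<open>x\<close> belongs to \<open>C\<close> and has been removed.
  Independence then upgrades to being a basis, as the cardinality is unchanged.\<close>

lemma basis_exchange_broken_circuit:
  assumes "pure_complex \<Psi>" "\<Psi> \<in> QC" "basis \<Psi> B"
    and C: "circuit \<Psi> C" "C - {Min C} \<subseteq> B" and x: "x \<in> C - {Min C}"
  shows "basis \<Psi> (insert (Min C) (B - {x}))"
proof -
  have osc: "ordered_simplicial_complex \<Psi>" using assms(2) unfolding QC_def by blast
  have ind: "independent \<Psi> B" using assms(3) unfolding basis_def by blast
  have "\<not> C \<subseteq> B"
    using C(1) independent_mono[OF osc ind] unfolding circuit_def by blast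
  then have "Min C \<notin> B" using C(2) by blast
  moreover have "finite B" "x \<in> B"
    using finite_independent[OF osc ind] C(2) x by auto
  ultimately have card: "card (insert (Min C) (B - {x})) = card B"
    using card_Suc_Diff1[of B x] by simp
  have "Min C \<in> C"
    using circuit_nonempty[OF osc C(1)] finite_circuit[OF osc C(1)] by simp
  then have sub: "insert (Min C) (B - {x}) \<subseteq> ground \<Psi>"
    using independent_subset_ground[OF osc ind] C(1) unfolding circuit_def by blast
  have "independent \<Psi> (insert (Min C) (B - {x}))"
  proof (rule ccontr)
    assume "\<not> ?thesis"
    then obtain C' where C': "circuit \<Psi> C'" "C' \<subseteq> insert (Min C) (B - {x})"
      using dependent_contains_circuit[OF osc sub] by blast
    then have "C' = C" using QC_circuit_unique[OF assms(2) ind C(1) _ C'(1)] C(2) by blast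
    then show False using C'(2) x by blast
  qed
  then show ?thesis using pure_independent_card_basis[OF osc assms(1,3)] card by blast
qed

lemma contains_no_broken_circuit_mono:
  assumes "contains_no_broken_circuit \<Psi> J" "I \<subseteq> J"
  shows "contains_no_broken_circuit \<Psi> I"
  using assms unfolding contains_no_broken_circuit_def by blast

lemma extends_to_nbc_basis:
  assumes "pure_complex \<Psi>" "\<Psi> \<in> QC"
    and "independent \<Psi> I" "contains_no_broken_circuit \<Psi> I"
  obtains B where "basis \<Psi> B" "contains_no_broken_circuit \<Psi> B" "I \<subseteq> B"
proof -
  have osc: "ordered_simplicial_complex \<Psi>" using assms(2) unfolding QC_def by blast
  \<comment> \<open>Counting the ground elements below \<open>b\<close> turns the order into natural
    numbers, which can be summed and minimised over bases.\<close>
  define rank where "rank b = card {e \<in> ground \<Psi>. e < b}" for b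
  obtain B0 where "basis \<Psi> B0 \<and> I \<subseteq> B0"
    using independent_extends_to_basis[OF osc assms(3)] by blast
  then obtain B where B: "basis \<Psi> B" "I \<subseteq> B"
    and least: "\<And>B'. basis \<Psi> B' \<Longrightarrow> I \<subseteq> B' \<Longrightarrow> sum rank B \<le> sum rank B'"
    using ex_has_least_nat[of "\<lambda>B. basis \<Psi> B \<and> I \<subseteq> B" B0 "sum rank"] by blast
  have "contains_no_broken_circuit \<Psi> B"
  proof (rule ccontr)
    assume "\<not> ?thesis"
    then obtain C where C: "circuit \<Psi> C" "C - {Min C} \<subseteq> B"
      unfolding contains_no_broken_circuit_def broken_circuit_def by blast
    \<comment> \<open>The broken circuit is not contained in \<open>I\<close>, so an element of it
      can be exchanged while keeping \<open>I\<close> inside the basis.\<close>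
    then obtain x where x: "x \<in> C - {Min C}" "x \<notin> I"
      using assms(4) unfolding contains_no_broken_circuit_def broken_circuit_def by blast
    have finC: "finite C" using finite_circuit[OF osc C(1)] .
    have "Min C \<in> C" using circuit_nonempty[OF osc C(1)] finC by simp
    then have "Min C \<in> ground \<Psi>" using C(1) unfolding circuit_def by blast
    moreover have "Min C < x" using finC x(1) Min_le[of C x] by (auto simp: order_less_le)
    \<comment> \<open>The inclusion is strict because \<open>Min C\<close> itself belongs only to
      the right-hand set.\<close>
    ultimately have "{e \<in> ground \<Psi>. e < Min C} \<subset> {e \<in> ground \<Psi>. e < x}" by auto
    moreover have "finite (ground \<Psi>)"
      using osc unfolding ordered_simplicial_complex_def by blast
    ultimately have "rank (Min C) < rank x"
      unfolding rank_def by (intro psubset_card_mono) auto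
    moreover have "finite B"
      using B(1) finite_independent[OF osc] unfolding basis_def by blast
    then have "sum rank B = rank x + sum rank (B - {x})"
      \<comment> \<open>The upper bound is enough here and holds whether or not \<open>Min C\<close>
        already lies in \<open>B - {x}\<close>.\<close>
      and "sum rank (insert (Min C) (B - {x})) \<le> rank (Min C) + sum rank (B - {x})"
      using C(2) x(1) sum.remove[of B x rank] by (auto simp: sum.insert_if)
    ultimately have "sum rank (insert (Min C) (B - {x})) < sum rank B" by linarith
    moreover have "basis \<Psi> (insert (Min C) (B - {x}))"
      using basis_exchange_broken_circuit[OF assms(1,2) B(1) C x(1)] .
    moreover have "I \<subseteq> insert (Min C) (B - {x})" using B(2) x(2) by blast
    ultimately show False using least not_less by blast
  qed
  then show thesis using that B by blast
qed

theorem lemma4p17: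
  fixes \<Psi> :: "'a::linorder complex" and I :: "'a set"
  assumes "ordered_simplicial_complex \<Psi>"
    and "pure_complex \<Psi>"
    and "\<Psi> \<in> QC"
    and "independent \<Psi> I"
  shows "independent (nbc \<Psi>) I \<longleftrightarrow> contains_no_broken_circuit \<Psi> I"
proof
  assume "independent (nbc \<Psi>) I"
  then obtain B where "contains_no_broken_circuit \<Psi> B" "I \<subseteq> B"
    unfolding nbc_def independent_def by auto
  then show "contains_no_broken_circuit \<Psi> I" by (rule contains_no_broken_circuit_mono)
next
  assume "contains_no_broken_circuit \<Psi> I"
  then obtain B where "basis \<Psi> B" "contains_no_broken_circuit \<Psi> B" "I \<subseteq> B"
    using extends_to_nbc_basis[OF assms(2-4)] by blast
  then show "independent (nbc \<Psi>) I" unfolding nbc_def independent_def by auto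
qed

end
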